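(* If $A\in\mathcal{KT}(\Delta^0_2)$, then $A$ is infinitely often $K$-trivial.
   Context: Reals are elements of $2^{\omega}$ (infinite binary sequences); $A\upharpoonright n$ is the initial segment of $A$ of length $n$. $K(\sigma)$ is the prefix-free Kolmogorov complexity of the finite binary string $\sigma$ with respect to a fixed universal prefix-free machine, and for $n \in \omega$, $K(n)$ denotes the complexity of the string of $n$ zeros. An order is a function $g:\omega\to\omega$ that is nondecreasing and unbounded (not necessarily recursive). For $g:\omega\to\omega$, $\mathcal{KT}(g)$ is the set of reals $A$ for which there is a constant $c$ such that for all $n\in\omega$, $K(A\upharpoonright n)\leq K(n)+g(n)+c$. $\mathcal{KT}(\Delta^0_2)$ is the intersection of $\mathcal{KT}(g)$ over all $\Delta^0_2$ orders $g$. A real $A$ is infinitely often $K$-trivial if there is a constant $c$ such that $K(A\upharpoonright n)\leq K(n)+c$ for infinitely many $n\in\omega$. *)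

theory Defs
  imports Main "HOL-Library.Nat_Bijection" "HOL-Library.Sublist" "HOL-Library.Infinite_Set"
begin

text \<open>
  Partial recursive functions on natural numbers (Kleene schemes). Terms carry no arity;
  \<open>eval r\<close> is read as a \<open>k\<close>-ary partial function by applying it to lists of length \<open>k\<close>.
  Arguments outside the intended arity yield \<open>None\<close> or are ignored, so no non-recursive
  function becomes definable.
\<close>

datatype recf =
    Zero
  | Succ
  | Proj nat
  | Comp recf "recf list"
  | PrimRec recf recf
  | Mu recf

fun eval :: "recf \<Rightarrow> nat list \<Rightarrow> nat option" where
  "eval Zero xs = Some 0"
| "eval Succ xs = (case xs of [] \<Rightarrow> None | x # _ \<Rightarrow> Some (Suc x))"
| "eval (Proj i) xs = (if i < length xs then Some (xs ! i) else None)"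
| "eval (Comp g fs) xs =
    (let ys = map (\<lambda>f. eval f xs) fs
     in if None \<in> set ys then None else eval g (map the ys))"
| "eval (PrimRec f g) xs =
    (case xs of
       [] \<Rightarrow> None
     | x # xs' \<Rightarrow>
         rec_nat (eval f xs') (\<lambda>n r. Option.bind r (\<lambda>y. eval g (n # y # xs'))) x)"
| "eval (Mu f) xs =
    (if \<exists>n. eval f (n # xs) = Some 0 \<and> (\<forall>m<n. eval f (m # xs) \<noteq> None)
     then Some (LEAST n. eval f (n # xs) = Some 0)
     else None)"

definition partial_recursive :: "(nat \<Rightarrow> nat option) \<Rightarrow> bool" where
  "partial_recursive f \<longleftrightarrow> (\<exists>r. \<forall>x. eval r [x] = f x)"

definition recursive_rel :: "nat \<Rightarrow> (nat list \<Rightarrow> bool) \<Rightarrow> bool" where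
  "recursive_rel k R \<longleftrightarrow>
    (\<exists>r. \<forall>xs. length xs = k \<longrightarrow> eval r xs = Some (of_bool (R xs)))"

definition Sigma02 :: "nat \<Rightarrow> (nat list \<Rightarrow> bool) \<Rightarrow> bool" where
  "Sigma02 k P \<longleftrightarrow>
    (\<exists>R. recursive_rel (k + 2) R \<and>
         (\<forall>xs. length xs = k \<longrightarrow> (P xs \<longleftrightarrow> (\<exists>u. \<forall>v. R (u # v # xs)))))"

definition Pi02 :: "nat \<Rightarrow> (nat list \<Rightarrow> bool) \<Rightarrow> bool" where
  "Pi02 k P \<longleftrightarrow>
    (\<exists>R. recursive_rel (k + 2) R \<and>
         (\<forall>xs. length xs = k \<longrightarrow> (P xs \<longleftrightarrow> (\<forall>u. \<exists>v. R (u # v # xs)))))"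

definition Delta02 :: "nat \<Rightarrow> (nat list \<Rightarrow> bool) \<Rightarrow> bool" where
  "Delta02 k P \<longleftrightarrow> Sigma02 k P \<and> Pi02 k P"

text \<open>A total function is \<open>\<Delta>\<^sup>0\<^sub>2\<close> if its graph is.\<close>

definition Delta02_fun :: "(nat \<Rightarrow> nat) \<Rightarrow> bool" where
  "Delta02_fun g \<longleftrightarrow> Delta02 2 (\<lambda>xs. g (xs ! 0) = xs ! 1)"

definition is_order :: "(nat \<Rightarrow> nat) \<Rightarrow> bool" where
  "is_order g \<longleftrightarrow> mono g \<and> (\<forall>k. \<exists>n. k \<le> g n)"

definition str_code :: "bool list \<Rightarrow> nat" where
  "str_code \<sigma> = list_encode (map of_bool \<sigma>)"

definition partial_recursive_str :: "(bool list \<Rightarrow> bool list option) \<Rightarrow> bool" where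
  "partial_recursive_str M \<longleftrightarrow>
    (\<exists>f. partial_recursive f \<and> (\<forall>\<sigma>. f (str_code \<sigma>) = map_option str_code (M \<sigma>)))"

definition prefix_free_machine :: "(bool list \<Rightarrow> bool list option) \<Rightarrow> bool" where
  "prefix_free_machine M \<longleftrightarrow>
    partial_recursive_str M \<and> (\<forall>\<sigma>\<in>dom M. \<forall>\<tau>\<in>dom M. prefix \<sigma> \<tau> \<longrightarrow> \<sigma> = \<tau>)"

definition universal_prefix_free_machine :: "(bool list \<Rightarrow> bool list option) \<Rightarrow> bool" where
  "universal_prefix_free_machine U \<longleftrightarrow>
    prefix_free_machine U \<and>
    (\<forall>M. prefix_free_machine M \<longrightarrow> (\<exists>\<rho>. \<forall>\<sigma>. U (\<rho> @ \<sigma>) = M \<sigma>))"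

text \<open>
  The minimum below is over a nonempty set when \<open>U\<close> is universal, because the machine with
  domain \<open>{[]}\<close> and value \<open>\<sigma>\<close> is prefix-free.
\<close>

definition K :: "(bool list \<Rightarrow> bool list option) \<Rightarrow> bool list \<Rightarrow> nat" where
  "K U \<sigma> = (LEAST n. \<exists>\<tau>. U \<tau> = Some \<sigma> \<and> length \<tau> = n)"

definition K_nat :: "(bool list \<Rightarrow> bool list option) \<Rightarrow> nat \<Rightarrow> nat" where
  "K_nat U n = K U (replicate n False)"

definition restr :: "(nat \<Rightarrow> bool) \<Rightarrow> nat \<Rightarrow> bool list" where
  "restr A n = map A [0..<n]"

definition KT :: "(bool list \<Rightarrow> bool list option) \<Rightarrow> (nat \<Rightarrow> nat) \<Rightarrow> (nat \<Rightarrow> bool) set" where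
  "KT U g = {A. \<exists>c. \<forall>n. K U (restr A n) \<le> K_nat U n + g n + c}"

definition KT_Delta02 :: "(bool list \<Rightarrow> bool list option) \<Rightarrow> (nat \<Rightarrow> bool) set" where
  "KT_Delta02 U = (\<Inter>g\<in>{g. is_order g \<and> Delta02_fun g}. KT U g)"

definition io_K_trivial :: "(bool list \<Rightarrow> bool list option) \<Rightarrow> (nat \<Rightarrow> bool) \<Rightarrow> bool" where
  "io_K_trivial U A \<longleftrightarrow> (\<exists>c. \<exists>\<^sub>\<infinity>n. K U (restr A n) \<le> K_nat U n + c)"

end

theory Submission
  imports Defs
begin

text \<open>
  If some program \<open>\<tau>\<close> outputs an initial segment of \<open>A\<close> that is at least as long as the number
  \<open>n\<close> coding \<open>\<tau>\<close>, then \<open>A\<restriction>n\<close> is computable from \<open>n\<close> alone: decode \<open>\<tau>\<close>, run it and truncate the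
  output to length \<open>n\<close>. Hence \<open>K(A\<restriction>n) \<le> K(n) + O(1)\<close>. Such programs exist as soon as infinitely
  many \<open>m\<close> satisfy that all strings of length \<open>K(A\<restriction>m)\<close> have code at most \<open>m\<close>. Taking for \<open>m\<close> the
  values \<open>h(k)\<close> of a fast growing recursive function, where \<open>K(h(k)) \<le> k + O(1)\<close>, and for \<open>g\<close> the
  (recursive) inverse of \<open>h\<close>, membership of \<open>A\<close> in \<open>KT(g)\<close> gives \<open>K(A\<restriction>h(k)) \<le> 2k + O(1)\<close>, which
  is enough.
\<close>

section \<open>Total recursive functions\<close>

definition computable :: "nat \<Rightarrow> (nat list \<Rightarrow> nat) \<Rightarrow> bool" where
  "computable k f \<longleftrightarrow> (\<exists>r. \<forall>xs. length xs = k \<longrightarrow> eval r xs = Some (f xs))"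

lemma eval_Comp_Some:
  assumes "map (\<lambda>f. eval f xs) fs = map Some vs"
  shows "eval (Comp g fs) xs = eval g vs"
proof -
  have "None \<notin> set (map Some vs)" by auto
  moreover have "map the (map Some vs) = vs" by (simp add: comp_def)
  ultimately show ?thesis unfolding eval.simps Let_def assms by simp
qed

lemma computable_proj: "i < k \<Longrightarrow> computable k (\<lambda>xs. xs ! i)"
  unfolding computable_def by (intro exI[of _ "Proj i"]) simp

lemma computable_comp1:
  assumes "computable 1 (\<lambda>xs. F (xs ! 0))" "computable k G"
  shows "computable k (\<lambda>xs. F (G xs))"
proof -
  obtain f g where f: "\<And>xs. length xs = 1 \<Longrightarrow> eval f xs = Some (F (xs ! 0))"
    and g: "\<And>xs. length xs = k \<Longrightarrow> eval g xs = Some (G xs)"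
    using assms unfolding computable_def by metis
  have "eval (Comp f [g]) xs = Some (F (G xs))" if "length xs = k" for xs
    using eval_Comp_Some[of xs "[g]" "[G xs]" f] f[of "[G xs]"] g[OF that] by simp
  then show ?thesis unfolding computable_def by blast
qed

lemma computable_comp2:
  assumes "computable 2 (\<lambda>xs. F (xs ! 0) (xs ! 1))" "computable k G" "computable k H"
  shows "computable k (\<lambda>xs. F (G xs) (H xs))"
proof -
  obtain f g h where f: "\<And>xs. length xs = 2 \<Longrightarrow> eval f xs = Some (F (xs ! 0) (xs ! 1))"
    and g: "\<And>xs. length xs = k \<Longrightarrow> eval g xs = Some (G xs)"
    and h: "\<And>xs. length xs = k \<Longrightarrow> eval h xs = Some (H xs)"
    using assms unfolding computable_def by metis
  have "eval (Comp f [g, h]) xs = Some (F (G xs) (H xs))" if "length xs = k" for xs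
    using eval_Comp_Some[of xs "[g, h]" "[G xs, H xs]" f] f[of "[G xs, H xs]"] g[OF that] h[OF that]
    by simp
  then show ?thesis unfolding computable_def by blast
qed

lemma computable_Suc:
  assumes "computable k G"
  shows "computable k (\<lambda>xs. Suc (G xs))"
proof (rule computable_comp1[OF _ assms])
  show "computable 1 (\<lambda>xs. Suc (xs ! 0))"
    unfolding computable_def by (intro exI[of _ Succ]) (auto simp: length_Suc_conv)
qed

lemma computable_const: "computable k (\<lambda>xs. c)"
proof (induction c)
  case 0
  show ?case unfolding computable_def by (intro exI[of _ Zero]) simp
next
  case (Suc c)
  then show ?case by (rule computable_Suc)
qed

lemma computable_primrec:
  assumes "computable k B" "computable (Suc (Suc k)) S" "computable k N"
  shows "computable k (\<lambda>xs. rec_nat (B xs) (\<lambda>j y. S (j # y # xs)) (N xs))"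
proof -
  obtain b s n where b: "\<And>xs. length xs = k \<Longrightarrow> eval b xs = Some (B xs)"
    and s: "\<And>xs. length xs = Suc (Suc k) \<Longrightarrow> eval s xs = Some (S xs)"
    and n: "\<And>xs. length xs = k \<Longrightarrow> eval n xs = Some (N xs)"
    using assms unfolding computable_def by metis
  \<comment> \<open>\<open>PrimRec\<close> recurses on the head of its argument list, so it is fed
    \<open>N xs\<close> followed by the parameters, which the projections reproduce.\<close>
  have "eval (Comp (PrimRec b s) (n # map Proj [0..<k])) xs =
      Some (rec_nat (B xs) (\<lambda>j y. S (j # y # xs)) (N xs))" if len: "length xs = k" for xs
  proof -
    have "map (\<lambda>f. eval f xs) (n # map Proj [0..<k]) = map Some (N xs # xs)"
      by (rule nth_equalityI) (auto simp: len n nth_Cons split: nat.split)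
    then have "eval (Comp (PrimRec b s) (n # map Proj [0..<k])) xs = eval (PrimRec b s) (N xs # xs)"
      by (rule eval_Comp_Some)
    also have "\<dots> = rec_nat (eval b xs) (\<lambda>j r. Option.bind r (\<lambda>y. eval s (j # y # xs))) (N xs)"
      by simp
    also have "\<dots> = Some (rec_nat (B xs) (\<lambda>j y. S (j # y # xs)) (N xs))"
      by (rule nat.induct) (simp_all add: b s len)
    finally show ?thesis .
  qed
  then show ?thesis unfolding computable_def by blast
qed

lemma computable_unaryE:
  assumes "computable 1 (\<lambda>xs. F (xs ! 0))"
  obtains r where "\<And>a. eval r [a] = Some (F a)"
proof -
  obtain r where "\<And>xs. length xs = 1 \<Longrightarrow> eval r xs = Some (F (xs ! 0))"
    using assms unfolding computable_def by blast
  from that[of r] this[of "[_]"] show thesis by simp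
qed

lemma computable_binaryE:
  assumes "computable 2 (\<lambda>xs. F (xs ! 0) (xs ! 1))"
  obtains r where "\<And>a b. eval r [a, b] = Some (F a b)"
proof -
  obtain r where "\<And>xs. length xs = 2 \<Longrightarrow> eval r xs = Some (F (xs ! 0) (xs ! 1))"
    using assms unfolding computable_def by blast
  from that[of r] this[of "[_, _]"] show thesis by simp
qed

section \<open>Minimization over total functions\<close>

lemma eval_Mu_total:
  assumes "\<And>n. eval f (n # xs) = Some (F n)"
  shows "eval (Mu f) xs = (if \<exists>n. F n = 0 then Some (LEAST n. F n = 0) else None)"
  using assms by simp

lemma eval_Mu_unique:
  assumes "\<And>n. eval f (n # xs) = Some (F n)" "\<And>n. F n = 0 \<longleftrightarrow> n = k"
  shows "eval (Mu f) xs = Some k"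
proof -
  have "(LEAST n. n = k) = k" by (rule Least_equality) simp_all
  then show ?thesis using eval_Mu_total[of f xs F] assms by (simp del: eval.simps)
qed

lemma computable_Least:
  assumes "computable (Suc k) F" "\<And>xs. \<exists>n. F (n # xs) = 0"
  shows "computable k (\<lambda>xs. LEAST n. F (n # xs) = 0)"
proof -
  obtain f where f: "\<And>xs. length xs = Suc k \<Longrightarrow> eval f xs = Some (F xs)"
    using assms unfolding computable_def by metis
  have "eval (Mu f) xs = Some (LEAST n. F (n # xs) = 0)" if "length xs = k" for xs
    using eval_Mu_total[of f xs "\<lambda>n. F (n # xs)"] f[of "_ # xs"] that assms(2) by simp
  then show ?thesis unfolding computable_def by blast
qed

text \<open>Iteration is primitive recursion whose step reads only the previous value, at position
  1. Addition, subtraction, constant strings and list access below are all iterations.\<close>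

lemma computable_funpow:
  assumes "computable 1 (\<lambda>xs. F (xs ! 0))" "computable k N" "computable k X"
  shows "computable k (\<lambda>xs. (F ^^ N xs) (X xs))"
proof -
  have "(F ^^ n) x = rec_nat x (\<lambda>j y. F ((j # y # xs) ! 1)) n" for n x and xs :: "nat list"
    by (induction n) simp_all
  then show ?thesis
    using computable_primrec[OF assms(3) computable_comp1[OF assms(1) computable_proj[of 1]] assms(2)]
    by simp
qed

section \<open>Arithmetic and the Cantor pairing function\<close>

lemma computable_add:
  assumes "computable k G" "computable k H"
  shows "computable k (\<lambda>xs. G xs + H xs)"
proof -
  have "(Suc ^^ n) x = x + n" for n x by (induction n) simp_all
  then show ?thesis
    using computable_funpow[OF computable_Suc[OF computable_proj] assms(2,1)] by (simp add: add.commute)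
qed

lemma computable_diff:
  assumes "computable k G" "computable k H"
  shows "computable k (\<lambda>xs. G xs - H xs)"
proof -
  \<comment> \<open>The predecessor comes from a recursion that returns its counter, with 0 at the
    base.\<close>
  have "rec_nat 0 (\<lambda>j y. (j # y # xs) ! 0) n = n - 1" for n and xs :: "nat list"
    by (cases n) simp_all
  then have "computable 1 (\<lambda>xs. xs ! 0 - 1)"
    using computable_primrec[OF computable_const[of 1 0] computable_proj[of 0 "Suc (Suc 1)"]
        computable_proj[of 0 1]] by simp
  moreover have "((\<lambda>x. x - 1) ^^ n) x = x - n" for n x :: nat by (induction n) simp_all
  ultimately show ?thesis
    using computable_funpow[of "\<lambda>x. x - 1", OF _ assms(2,1)] by simp
qed

lemma computable_triangle:
  assumes "computable k G"
  shows "computable k (\<lambda>xs. triangle (G xs))"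
proof (rule computable_comp1[OF _ assms])
  have "rec_nat 0 (\<lambda>j y. (\<lambda>zs. zs ! 1 + Suc (zs ! 0)) (j # y # xs)) n = triangle n"
    for n and xs :: "nat list"
    by (induction n) simp_all
  then show "computable 1 (\<lambda>xs. triangle (xs ! 0))"
    using computable_primrec[OF computable_const[of 1 0]
        computable_add[OF computable_proj[of 1 "Suc (Suc 1)"]
          computable_Suc[OF computable_proj[of 0 "Suc (Suc 1)"]]]
        computable_proj[of 0 1]] by simp
qed

lemma computable_prod_encode:
  assumes "computable k G" "computable k H"
  shows "computable k (\<lambda>xs. prod_encode (G xs, H xs))"
  unfolding prod_encode_def
  by (simp add: computable_add computable_triangle assms)

text \<open>Here \<open>s z\<close> is the diagonal of \<open>z\<close>, the sum of its two
  components: the least \<open>n\<close> with \<open>z < triangle (Suc n)\<close>, written as a zero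
  test so that \<open>Mu\<close> can find it.\<close>

lemma prod_decode_conv_Least:
  defines "s \<equiv> \<lambda>z. LEAST n. Suc z - triangle (Suc n) = 0"
  shows "fst (prod_decode z) = z - triangle (s z)"
    and "snd (prod_decode z) = s z - (z - triangle (s z))"
proof -
  obtain a b where ab: "prod_decode z = (a, b)" by force
  then have z: "z = triangle (a + b) + a"
    using prod_decode_inverse[of z] by (simp add: prod_encode_def)
  have mono: "triangle i \<le> triangle j" if "i \<le> j" for i j
    using that by (induction rule: dec_induct) simp_all
  have "s z = a + b" unfolding s_def
  proof (rule Least_equality)
    show "Suc z - triangle (Suc (a + b)) = 0" by (simp add: z)
    show "a + b \<le> n" if "Suc z - triangle (Suc n) = 0" for n
    proof (rule ccontr)
      assume "\<not> a + b \<le> n"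
      then have "triangle (Suc n) \<le> triangle (a + b)" by (intro mono) simp
      with that z show False by linarith
    qed
  qed
  with ab z show "fst (prod_decode z) = z - triangle (s z)"
    "snd (prod_decode z) = s z - (z - triangle (s z))" by simp_all
qed

lemma computable_prod_decode:
  assumes "computable k G"
  shows "computable k (\<lambda>xs. fst (prod_decode (G xs)))"
    and "computable k (\<lambda>xs. snd (prod_decode (G xs)))"
proof -
  have ex: "\<exists>n. Suc ((n # xs) ! 1) - triangle (Suc ((n # xs) ! 0)) = 0" for xs
    by (rule exI[of _ "xs ! 0"]) simp
  have "computable (Suc 1) (\<lambda>xs. Suc (xs ! 1) - triangle (Suc (xs ! 0)))"
    by (intro computable_diff computable_Suc computable_triangle computable_proj) simp_all
  from computable_Least[OF this ex]
  have s: "computable 1 (\<lambda>xs. LEAST n. Suc (xs ! 0) - triangle (Suc n) = 0)"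
    by (simp del: triangle_Suc)
  show "computable k (\<lambda>xs. fst (prod_decode (G xs)))"
    unfolding prod_decode_conv_Least(1)
    by (intro computable_diff computable_triangle computable_comp1[OF s] assms)
  show "computable k (\<lambda>xs. snd (prod_decode (G xs)))"
    unfolding prod_decode_conv_Least(2)
    by (intro computable_diff computable_triangle computable_comp1[OF s] assms)
qed

text \<open>Turns equality into the vanishing of a computable function, the form that
  \<open>Mu\<close> searches for.\<close>

lemma eq_iff_diffs: "a = b \<longleftrightarrow> (a - b) + (b - a) = (0::nat)"
  by linarith

section \<open>String codes\<close>

text \<open>The \<open>Cons\<close> case of \<open>list_encode\<close>, acting on a tail that is
  already encoded.\<close>

definition cons_code :: "nat \<Rightarrow> nat \<Rightarrow> nat" where
  "cons_code x y = Suc (prod_encode (x, y))"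

lemma computable_cons_code:
  "computable k G \<Longrightarrow> computable k H \<Longrightarrow> computable k (\<lambda>xs. cons_code (G xs) (H xs))"
  unfolding cons_code_def by (intro computable_Suc computable_prod_encode)

lemma str_code_Nil [simp]: "str_code [] = 0"
  by (simp add: str_code_def)

lemma str_code_Cons [simp]: "str_code (b # \<sigma>) = cons_code (of_bool b) (str_code \<sigma>)"
  by (simp add: str_code_def cons_code_def)

lemma inj_str_code: "inj str_code"
proof (rule injI)
  fix \<sigma> \<tau> assume "str_code \<sigma> = str_code \<tau>"
  then have "map of_bool \<sigma> = (map of_bool \<tau> :: nat list)"
    unfolding str_code_def using inj_list_encode by (blast dest: injD)
  then show "\<sigma> = \<tau>"
    by (rule map_injective) (auto intro!: injI split: if_splits simp: of_bool_def)
qed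

lemma str_code_replicate_append:
  "str_code (replicate n b @ \<sigma>) = (cons_code (of_bool b) ^^ n) (str_code \<sigma>)"
  by (induction n) simp_all

lemma str_code_replicate: "str_code (replicate n b) = (cons_code (of_bool b) ^^ n) 0"
  using str_code_replicate_append[of n b "[]"] by simp

lemma cons_code_mono: "x \<le> x' \<Longrightarrow> y \<le> y' \<Longrightarrow> cons_code x y \<le> cons_code x' y'"
proof -
  assume *: "x \<le> x'" "y \<le> y'"
  have "triangle i \<le> triangle j" if "i \<le> j" for i j
    using that by (induction rule: dec_induct) simp_all
  from this[of "x + y" "x' + y'"] * show ?thesis
    by (simp add: cons_code_def prod_encode_def)
qed

lemma less_cons_code: "y < cons_code x y"
  by (simp add: cons_code_def le_imp_less_Suc le_prod_encode_2)

lemma strict_mono_str_code_replicate: "strict_mono (\<lambda>n. str_code (replicate n b))"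
  unfolding strict_mono_Suc_iff by (simp add: less_cons_code)

text \<open>Pairing is monotone and bits are at most 1, so the all-\<open>True\<close> string has
  the largest code of its length. This bounds the code of a program by its length.\<close>

lemma str_code_le_replicate: "str_code \<sigma> \<le> str_code (replicate (length \<sigma>) True)"
  by (induction \<sigma>) (simp_all add: cons_code_mono)

text \<open>Subtracting 1 removes the \<open>Suc\<close> of \<open>cons_code\<close>; the iterate
  drops \<open>i\<close> entries and \<open>fst\<close> reads the head. The result is defined for
  every \<open>z\<close>.\<close>

definition nth_code :: "nat \<Rightarrow> nat \<Rightarrow> nat" where
  "nth_code z i = fst (prod_decode (((\<lambda>z. snd (prod_decode (z - 1))) ^^ i) z - 1))"

lemma computable_nth_code:
  assumes "computable k G" "computable k H"
  shows "computable k (\<lambda>xs. nth_code (G xs) (H xs))"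
  unfolding nth_code_def
  by (intro computable_prod_decode computable_diff computable_funpow computable_const assms
      computable_proj) simp_all

lemma nth_code_str_code: "i < length \<sigma> \<Longrightarrow> nth_code (str_code \<sigma>) i = of_bool (\<sigma> ! i)"
proof (induction \<sigma> arbitrary: i)
  case (Cons b \<sigma>)
  show ?case
  proof (cases i)
    case 0
    then show ?thesis by (simp add: nth_code_def cons_code_def)
  next
    case (Suc j)
    have "nth_code (str_code (b # \<sigma>)) (Suc j) = nth_code (str_code \<sigma>) j"
      by (simp add: nth_code_def cons_code_def funpow_Suc_right del: funpow.simps)
    with Suc Cons show ?thesis by simp
  qed
qed simp

text \<open>
  Nonzero entries are read as \<open>True\<close>, so that the result is a string even if \<open>z\<close> does not code one.
\<close>

definition take_code :: "nat \<Rightarrow> nat \<Rightarrow> nat" where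
  "take_code z n = str_code (map (\<lambda>i. nth_code z i \<noteq> 0) [0..<n])"

lemma take_code_str_code:
  assumes "n \<le> length \<sigma>"
  shows "take_code (str_code \<sigma>) n = str_code (take n \<sigma>)"
proof -
  have "map (\<lambda>i. nth_code (str_code \<sigma>) i \<noteq> 0) [0..<n] = take n \<sigma>"
    using assms by (intro nth_equalityI) (simp_all add: nth_code_str_code)
  then show ?thesis by (simp add: take_code_def)
qed

lemma computable_take_code: "computable 2 (\<lambda>xs. take_code (xs ! 0) (xs ! 1))"
proof -
  \<comment> \<open>The string is built from its right end. Positions 0 to 3 hold the counter, the
    code so far, \<open>z\<close> and \<open>n\<close>; \<open>1 - (1 - a)\<close> maps nonzero
    entries to 1.\<close>
  define S where "S = (\<lambda>xs. cons_code (1 - (1 - nth_code (xs ! 2) (xs ! 3 - Suc (xs ! 0)))) (xs ! 1))"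
  \<comment> \<open>Invariant: after \<open>j\<close> rounds the last \<open>j\<close> bits are
    encoded.\<close>
  have "rec_nat 0 (\<lambda>j y. S (j # y # xs)) j =
      str_code (map (\<lambda>i. nth_code (xs ! 0) i \<noteq> 0) [xs ! 1 - j..<xs ! 1])"
    if "j \<le> xs ! 1" for xs j
    using that
  proof (induction j)
    case (Suc j)
    let ?n = "xs ! 1"
    have "[?n - Suc j..<?n] = (?n - Suc j) # [?n - j..<?n]"
      using Suc.prems by (simp add: upt_conv_Cons Suc_diff_Suc)
    moreover have "1 - (1 - a) = (of_bool (0 < a) :: nat)" for a :: nat
      by (cases a) simp_all
    ultimately show ?case using Suc by (simp add: S_def)
  qed simp
  then have eq: "rec_nat 0 (\<lambda>j y. S (j # y # xs)) (xs ! 1) = take_code (xs ! 0) (xs ! 1)" for xs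
    by (simp add: take_code_def)
  have "computable (Suc (Suc 2)) S"
    unfolding S_def
    by (intro computable_cons_code computable_diff computable_const computable_nth_code
        computable_Suc computable_proj) simp_all
  from computable_primrec[OF computable_const[of 2 0] this computable_proj[of 1]]
  show ?thesis using eq by simp
qed

section \<open>Machines and complexity\<close>

lemma partial_recursive_strI:
  assumes "\<And>\<sigma>. eval r [str_code \<sigma>] = map_option str_code (M \<sigma>)"
  shows "partial_recursive_str M"
  unfolding partial_recursive_str_def partial_recursive_def
  by (rule exI[of _ "\<lambda>x. eval r [x]"]) (use assms in blast)

lemma K_le: "U \<tau> = Some \<sigma> \<Longrightarrow> K U \<sigma> \<le> length \<tau>"
  unfolding K_def by (rule Least_le) blast

lemma K_attained:
  assumes "U \<tau> = Some \<sigma>"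
  obtains \<tau>' where "U \<tau>' = Some \<sigma>" "length \<tau>' = K U \<sigma>"
  using LeastI[of "\<lambda>n. \<exists>\<tau>. U \<tau> = Some \<sigma> \<and> length \<tau> = n" "length \<tau>"] assms
  unfolding K_def by blast

lemma universal_bound:
  assumes "universal_prefix_free_machine U" "prefix_free_machine M"
  obtains c where "\<And>\<tau> \<sigma>. M \<tau> = Some \<sigma> \<Longrightarrow> K U \<sigma> \<le> length \<tau> + c"
proof -
  obtain \<rho> where "\<And>\<sigma>. U (\<rho> @ \<sigma>) = M \<sigma>"
    using assms unfolding universal_prefix_free_machine_def by blast
  then have "K U \<sigma> \<le> length \<tau> + length \<rho>" if "M \<tau> = Some \<sigma>" for \<tau> \<sigma>
    using K_le[of U "\<rho> @ \<tau>" \<sigma>] that by simp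
  then show thesis by (rule that)
qed

text \<open>Ensures that \<open>K\<close> is a minimum over a nonempty set. The machine used halts
  only on the empty program.\<close>

lemma universal_surj:
  assumes "universal_prefix_free_machine U"
  obtains \<tau> where "U \<tau> = Some \<sigma>"
proof -
  define M :: "bool list \<Rightarrow> bool list option" where "M = [[] \<mapsto> \<sigma>]"
  obtain c where c: "\<And>x. eval c [x] = Some (str_code \<sigma>)"
    using computable_unaryE[OF computable_const[of 1 "str_code \<sigma>"]] by blast
  have "eval (Comp c [Mu (Proj 1)]) [str_code \<tau>] = map_option str_code (M \<tau>)" for \<tau>
  proof -
    \<comment> \<open>\<open>Proj 1\<close> reads the input instead of the search variable, so the
      search halts at once on the code 0 of \<open>[]\<close> and diverges on all other
      inputs.\<close>
    have mu: "eval (Mu (Proj 1)) [x] = (if x = 0 then Some 0 else None)" for x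
      using eval_Mu_total[of "Proj 1" "[x]" "\<lambda>_. x"] by simp
    have "str_code \<tau> = 0 \<longleftrightarrow> \<tau> = []"
      using inj_str_code[THEN inj_eq, of \<tau> "[]"] by simp
    with mu[of "str_code \<tau>"] c show ?thesis by (simp add: M_def Let_def del: eval.simps(6))
  qed
  then have "partial_recursive_str M" by (rule partial_recursive_strI)
  then have "prefix_free_machine M"
    by (simp add: prefix_free_machine_def M_def)
  then obtain \<rho> where "\<And>\<tau>. U (\<rho> @ \<tau>) = M \<tau>"
    using assms unfolding universal_prefix_free_machine_def by blast
  then have "U \<rho> = Some \<sigma>" by (metis M_def append_Nil2 fun_upd_same)
  then show thesis by (rule that)
qed

text \<open>The strings of \<open>k\<close> zeros followed by a one form a prefix-free set, so a
  machine may map the \<open>k\<close>-th of them to \<open>h k\<close> zeros.\<close>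

lemma K_nat_computable_le:
  assumes U: "universal_prefix_free_machine U" and h: "computable 1 (\<lambda>xs. h (xs ! 0))"
  obtains c where "\<And>k. K_nat U (h k) \<le> k + c"
proof -
  let ?p = "\<lambda>k. replicate k False @ [True]"
  define M where "M \<tau> = (if \<exists>k. \<tau> = ?p k
    then Some (replicate (h (length \<tau> - 1)) False) else None)" for \<tau>
  have M: "M (?p k) = Some (replicate (h k) False)" for k by (auto simp: M_def)
  have p_prefix: "k = l" if "prefix (?p k) (?p l)" for k l
  proof -
    from that obtain zs where zs: "?p l = ?p k @ zs" unfolding prefix_def by blast
    have "k \<le> l" using arg_cong[OF zs, of length] by simp
    \<comment> \<open>\<open>?p k\<close> has a one at index \<open>k\<close>, whereas
      \<open>?p l\<close> has only zeros below index \<open>l\<close>.\<close>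
    moreover have "?p l ! k" unfolding zs by (simp add: nth_append)
    ultimately show "k = l" by (cases "k < l") (auto simp: nth_append)
  qed
  \<comment> \<open>Minimizing \<open>?d\<close> over \<open>k\<close> recovers \<open>k\<close>
    from the code of \<open>?p k\<close> and diverges on any other string.\<close>
  let ?d = "\<lambda>k x. (str_code (?p k) - x) + (x - str_code (?p k))"
  have "computable 2 (\<lambda>xs. ?d (xs ! 0) (xs ! 1))"
    unfolding str_code_replicate_append
    by (intro computable_add computable_diff computable_funpow computable_cons_code
        computable_const computable_proj) simp_all
  from computable_binaryE[OF this]
  obtain d where d: "\<And>k x. eval d [k, x] = Some (?d k x)" by blast
  have "computable 1 (\<lambda>xs. str_code (replicate (h (xs ! 0)) False))"
    unfolding str_code_replicate
    by (intro computable_funpow computable_cons_code computable_const computable_proj h) simp_all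
  from computable_unaryE[OF this]
  obtain e where e: "\<And>k. eval e [k] = Some (str_code (replicate (h k) False))" by blast
  have "eval (Comp e [Mu d]) [str_code \<tau>] = map_option str_code (M \<tau>)" for \<tau>
  proof (cases "\<exists>k. \<tau> = ?p k")
    case True
    then obtain k where k: "\<tau> = ?p k" by blast
    have z: "?d l (str_code \<tau>) = 0 \<longleftrightarrow> l = k" for l
      unfolding eq_iff_diffs[symmetric] k using inj_str_code[THEN inj_eq, of "?p l" "?p k"] p_prefix[of l k]
      by auto
    have "eval (Mu d) [str_code \<tau>] = Some k"
      by (rule eval_Mu_unique[OF d z])
    then show ?thesis
      using eval_Comp_Some[of "[str_code \<tau>]" "[Mu d]" "[k]" e] e M k by (simp del: eval.simps)
  next
    case False
    then have z: "?d l (str_code \<tau>) \<noteq> 0" for l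
      unfolding eq_iff_diffs[symmetric] using inj_str_code[THEN inj_eq, of "?p l" \<tau>] by metis
    have "eval (Mu d) [str_code \<tau>] = None"
      using eval_Mu_total[of d "[str_code \<tau>]" "\<lambda>l. ?d l (str_code \<tau>)"] d z
      by (simp del: eval.simps add_is_0)
    with False show ?thesis by (simp add: M_def Let_def del: eval.simps(6))
  qed
  then have "partial_recursive_str M" by (rule partial_recursive_strI)
  moreover have "\<tau> = \<tau>'" if "\<tau> \<in> dom M" "\<tau>' \<in> dom M" "prefix \<tau> \<tau>'" for \<tau> \<tau>'
  proof -
    from that(1,2) obtain k l where "\<tau> = ?p k" "\<tau>' = ?p l"
      unfolding M_def dom_def by (auto split: if_splits)
    with that(3) p_prefix[of k l] show ?thesis by simp
  qed
  ultimately have "prefix_free_machine M" by (simp add: prefix_free_machine_def)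
  from universal_bound[OF U this]
  obtain c where c: "\<And>\<tau> \<sigma>. M \<tau> = Some \<sigma> \<Longrightarrow> K U \<sigma> \<le> length \<tau> + c" by blast
  \<comment> \<open>The extra 1 is the terminating bit of \<open>?p k\<close>.\<close>
  have "K_nat U (h k) \<le> k + Suc c" for k
    using c[OF M, of k] by (simp add: K_nat_def)
  then show thesis by (rule that)
qed

text \<open>A program for \<open>n\<close> zeros, where \<open>n\<close> is the code of
  \<open>\<tau>\<close>, yields \<open>n\<close> and hence \<open>\<tau>\<close>; the output of
  \<open>\<tau>\<close> is then cut to length \<open>n\<close>.\<close>

lemma K_take_le_K_nat:
  assumes U: "universal_prefix_free_machine U"
  obtains c where "\<And>\<tau> \<sigma>. U \<tau> = Some \<sigma> \<Longrightarrow> str_code \<tau> \<le> length \<sigma> \<Longrightarrow>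
    K U (take (str_code \<tau>) \<sigma>) \<le> K_nat U (str_code \<tau>) + c"
proof -
  have pfU: "prefix_free_machine U" using U by (simp add: universal_prefix_free_machine_def)
  then obtain r where r: "\<And>\<sigma>. eval r [str_code \<sigma>] = map_option str_code (U \<sigma>)"
    unfolding prefix_free_machine_def partial_recursive_str_def partial_recursive_def by metis
  let ?z = "\<lambda>n. str_code (replicate n False)"
  let ?d = "\<lambda>n y. (?z n - y) + (y - ?z n)"
  have "computable 2 (\<lambda>xs. ?d (xs ! 0) (xs ! 1))"
    unfolding str_code_replicate
    by (intro computable_add computable_diff computable_funpow computable_cons_code
        computable_const computable_proj) simp_all
  from computable_binaryE[OF this]
  obtain d where d: "\<And>n y. eval d [n, y] = Some (?d n y)" by blast
  obtain t where t: "\<And>z n. eval t [z, n] = Some (take_code z n)"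
    using computable_binaryE[OF computable_take_code] by blast
  \<comment> \<open>\<open>N\<close> runs \<open>U\<close> on the input and returns the number of
    zeros printed, diverging on other outputs. \<open>f\<close> then runs \<open>U\<close> on the
    string coded by that number and truncates.\<close>
  define N where "N = Comp (Mu d) [r]"
  define f where "f = Comp t [Comp r [N], N]"
  \<comment> \<open>Decoding with \<open>inv str_code\<close> is sound because
    \<open>take_code\<close> always returns the code of a string.\<close>
  define M where "M \<tau> = map_option (inv str_code) (eval f [str_code \<tau>])" for \<tau>
  have dom: "\<tau> \<in> dom U" and range: "w \<in> range str_code" if "eval f [str_code \<tau>] = Some w" for \<tau> w
  proof -
    have "eval N [str_code \<tau>] \<noteq> None"
      using that by (simp add: f_def Let_def split: if_splits) (metis not_None_eq)
    then have "eval r [str_code \<tau>] \<noteq> None"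
      by (cases "eval r [str_code \<tau>]") (auto simp: N_def Let_def simp del: eval.simps(6))
    with r show "\<tau> \<in> dom U" by auto
    show "w \<in> range str_code"
      using that t by (auto simp: f_def Let_def take_code_def split: if_splits)
  qed
  have "eval f [str_code \<tau>] = map_option str_code (M \<tau>)" for \<tau>
    using range[of \<tau>] by (cases "eval f [str_code \<tau>]") (auto simp: M_def f_inv_into_f)
  then have "partial_recursive_str M" by (rule partial_recursive_strI)
  \<comment> \<open>\<open>f\<close> starts by running \<open>U\<close> on its own input, so
    prefix-freeness is inherited from \<open>U\<close>.\<close>
  moreover have "dom M \<subseteq> dom U"
    using dom unfolding M_def dom_def by fastforce
  ultimately have "prefix_free_machine M"
    using pfU unfolding prefix_free_machine_def by blast
  from universal_bound[OF U this]
  obtain c where c: "\<And>\<tau> \<sigma>. M \<tau> = Some \<sigma> \<Longrightarrow> K U \<sigma> \<le> length \<tau> + c" by blast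
  have "K U (take (str_code \<tau>) \<sigma>) \<le> K_nat U (str_code \<tau>) + c"
    if \<tau>: "U \<tau> = Some \<sigma>" and len: "str_code \<tau> \<le> length \<sigma>" for \<tau> \<sigma>
  proof -
    let ?n = "str_code \<tau>"
    obtain \<rho>' where "U \<rho>' = Some (replicate ?n False)" using universal_surj[OF U] .
    then obtain \<rho> where \<rho>: "U \<rho> = Some (replicate ?n False)"
      "length \<rho> = K U (replicate ?n False)" by (rule K_attained)
    have z: "?d l (?z ?n) = 0 \<longleftrightarrow> l = ?n" for l
      unfolding eq_iff_diffs[symmetric] by (rule strict_mono_eq[OF strict_mono_str_code_replicate])
    have "eval (Mu d) [?z ?n] = Some ?n"
      by (rule eval_Mu_unique[OF d z])
    then have N: "eval N [str_code \<rho>] = Some ?n"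
      using eval_Comp_Some[of "[str_code \<rho>]" "[r]" "[?z ?n]" "Mu d"] r[of \<rho>] \<rho>
      by (simp add: N_def del: eval.simps)
    then have "eval (Comp r [N]) [str_code \<rho>] = Some (str_code \<sigma>)"
      using eval_Comp_Some[of "[str_code \<rho>]" "[N]" "[?n]" r] r[of \<tau>] \<tau> by (simp del: eval.simps)
    with N have "eval f [str_code \<rho>] = Some (take_code (str_code \<sigma>) ?n)"
      using eval_Comp_Some[of "[str_code \<rho>]" "[Comp r [N], N]" "[str_code \<sigma>, ?n]" t] t
      by (simp add: f_def del: eval.simps)
    then have "M \<rho> = Some (take ?n \<sigma>)"
      using len inj_str_code by (simp add: M_def take_code_str_code)
    from c[OF this] \<rho>(2) show ?thesis by (simp add: K_nat_def)
  qed
  then show thesis by (rule that)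
qed

lemma Delta02_fun_computable:
  assumes "computable 1 (\<lambda>xs. g (xs ! 0))"
  shows "Delta02_fun g"
proof -
  \<comment> \<open>The two quantified numbers occupy positions 0 and 1. The graph is recursive, so
    one matrix serves both the Sigma and the Pi form.\<close>
  let ?R = "\<lambda>xs. g (xs ! 2) = xs ! 3"
  have "computable 4 (\<lambda>xs. 1 - ((g (xs ! 2) - xs ! 3) + (xs ! 3 - g (xs ! 2))))"
    by (intro computable_diff computable_add computable_const computable_comp1[OF assms]
        computable_proj) simp_all
  moreover have "1 - ((a - b) + (b - a)) = (of_bool (a = b) :: nat)" for a b :: nat
    by auto
  ultimately have "computable 4 (\<lambda>xs. of_bool (?R xs))" by simp
  then have "recursive_rel (2 + 2) ?R"
    unfolding recursive_rel_def computable_def by simp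
  then show ?thesis
    unfolding Delta02_fun_def Delta02_def Sigma02_def Pi02_def
    by (intro conjI exI[of _ ?R]) (simp_all add: numeral_eq_Suc)
qed

theorem mainTheorem3:
  fixes U :: "bool list \<Rightarrow> bool list option" and A :: "nat \<Rightarrow> bool"
  assumes "universal_prefix_free_machine U"
    and "A \<in> KT_Delta02 U"
  shows "io_K_trivial U A"
proof -
  \<comment> \<open>The factor 3 leaves room for a summand \<open>k\<close> from
    \<open>K_nat U (h k)\<close>, another from \<open>g (h k)\<close>, and a third that absorbs the
    constants.\<close>
  define h where "h k = str_code (replicate (k + k + k) True)" for k
  define g where "g x = (LEAST k. x - h k = 0)" for x
  have sm: "strict_mono h"
    unfolding h_def using strict_mono_str_code_replicate[of True]
    by (auto simp: strict_mono_def)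
  then have le_h: "k \<le> h k" for k by (rule strict_mono_imp_increasing)
  have comp_h: "computable 1 (\<lambda>xs. h (xs ! 0))"
    unfolding h_def str_code_replicate
    by (intro computable_funpow computable_cons_code computable_add computable_const
        computable_proj) simp_all
  have "computable (Suc 1) (\<lambda>xs. xs ! 1 - h (xs ! 0))"
    by (intro computable_diff computable_comp1[OF comp_h] computable_proj) simp_all
  from computable_Least[OF this] have "computable 1 (\<lambda>xs. g (xs ! 0))"
    using le_h by (auto simp: g_def)
  then have "Delta02_fun g" by (rule Delta02_fun_computable)
  \<comment> \<open>\<open>g\<close> and \<open>h\<close> form a Galois connection; monotonicity and
    unboundedness of \<open>g\<close>, and \<open>g (h k) \<le> k\<close>, all follow from
    it.\<close>
  have g_le_iff: "g x \<le> k \<longleftrightarrow> x \<le> h k" for x k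
  proof
    have "x - h (g x) = 0"
      unfolding g_def using LeastI[of "\<lambda>k. x - h k = 0" x] le_h[of x] by simp
    then have "x \<le> h (g x)" by simp
    moreover assume "g x \<le> k"
    then have "h (g x) \<le> h k" by (simp only: strict_mono_less_eq[OF sm])
    ultimately show "x \<le> h k" by (rule le_trans)
  next
    assume "x \<le> h k"
    then show "g x \<le> k"
      unfolding g_def using Least_le[of "\<lambda>k. x - h k = 0" k] by simp
  qed
  have "is_order g" unfolding is_order_def
  proof
    show "mono g" 
    proof (rule monoI)
      show "g x \<le> g y" if "x \<le> y" for x y
        using that g_le_iff[of x "g y"] g_le_iff[of y "g y"] by simp
    qed
    have "k \<le> g (Suc (h k))" for k using g_le_iff[of "Suc (h k)" k] by simp
    then show "\<forall>k. \<exists>n. k \<le> g n" by blast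
  qed
  with \<open>Delta02_fun g\<close> assms(2) obtain c where c: "\<And>n. K U (restr A n) \<le> K_nat U n + g n + c"
    unfolding KT_Delta02_def KT_def by blast
  obtain c1 where c1: "\<And>k. K_nat U (h k) \<le> k + c1"
    using K_nat_computable_le[OF assms(1) comp_h] by blast
  obtain c2 where c2: "\<And>\<tau> \<sigma>. U \<tau> = Some \<sigma> \<Longrightarrow> str_code \<tau> \<le> length \<sigma> \<Longrightarrow>
    K U (take (str_code \<tau>) \<sigma>) \<le> K_nat U (str_code \<tau>) + c2"
    using K_take_le_K_nat[OF assms(1)] by blast
  have "\<exists>\<tau>. U \<tau> = Some (restr A (h k)) \<and> length \<tau> = K U (restr A (h k))" for k
  proof -
    obtain \<tau> where "U \<tau> = Some (restr A (h k))" using universal_surj[OF assms(1)] .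
    then show ?thesis by (rule K_attained) blast
  qed
  then obtain p where p: "\<And>k. U (p k) = Some (restr A (h k))"
    "\<And>k. length (p k) = K U (restr A (h k))" by metis
  \<comment> \<open>The outputs have distinct lengths \<open>h k\<close>. Hence the codes of the
    \<open>p k\<close> give infinitely many lengths \<open>n\<close>.\<close>
  have "inj p"
  proof (rule injI)
    fix k l assume "p k = p l"
    then have "length (restr A (h k)) = length (restr A (h l))" by (metis p(1) option.inject)
    then show "k = l" using sm by (simp add: restr_def strict_mono_eq)
  qed
  have "K U (restr A (str_code (p k))) \<le> K_nat U (str_code (p k)) + c2" if "c + c1 \<le> k" for k
  proof -
    \<comment> \<open>The length is at most \<open>(k + c1) + k + c\<close>, and \<open>k\<close> is
      at least \<open>c + c1\<close>.\<close>
    have "length (p k) \<le> k + k + k"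
      using p(2)[of k] c[of "h k"] c1[of k] g_le_iff[of "h k" k] that by simp
    then have "str_code (replicate (length (p k)) True) \<le> h k"
      unfolding h_def by (simp only: strict_mono_less_eq[OF strict_mono_str_code_replicate])
    with str_code_le_replicate have "str_code (p k) \<le> h k" by (rule le_trans)
    \<comment> \<open>Since the code of \<open>p k\<close> is at most \<open>h k\<close>, cutting
      \<open>restr A (h k)\<close> to that length gives an initial segment of \<open>A\<close>
      again.\<close>
    with c2[OF p(1)[of k]] show ?thesis by (simp add: restr_def take_map)
  qed
  then have "(\<lambda>k. str_code (p k)) ` {c + c1..} \<subseteq> {n. K U (restr A n) \<le> K_nat U n + c2}" by auto
  moreover have "inj_on (\<lambda>k. str_code (p k)) {c + c1..}"
    by (intro inj_onI) (simp add: inj_eq[OF inj_str_code] inj_eq[OF \<open>inj p\<close>])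
  then have "infinite ((\<lambda>k. str_code (p k)) ` {c + c1..})"
    by (simp add: finite_image_iff infinite_Ici)
  ultimately have "\<exists>\<^sub>\<infinity>n. K U (restr A n) \<le> K_nat U n + c2"
    unfolding INFM_iff_infinite by (rule infinite_super)
  then show ?thesis unfolding io_K_trivial_def by blast
qed

end
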